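(* The following series identity holds: $$\sum_{k=0}^{\infty}\left(\frac{1}{4}\right)^k\frac{(1)_k^2}{(\frac{5}{4})_k(\frac{7}{4})_k}\left\{\frac{5+6k}{1+2k}H_{k}^{(2)}-\frac{24+32k}{(1+2k)^3}\right\}=-24\beta(4).$$
   Context: For a complex number $x$ and a nonnegative integer $n$, the shifted factorial is $(x)_0=1$ and $(x)_n=x(x+1)\cdots(x+n-1)$ for $n\ge 1$; $(x)_n^m$ denotes $((x)_n)^m$. The harmonic numbers of order 2 are $H_n^{(2)}=\sum_{j=1}^n \frac{1}{j^2}$, with $H_0^{(2)}=0$. The constant $\beta(4)$ is $\beta(4)=\sum_{k=0}^{\infty}\frac{(-1)^k}{(1+2k)^4}$. *)

theory Defs
  imports Complex_Main
begin

definition harm2 :: "nat \<Rightarrow> real" where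
  "harm2 n = (\<Sum>j=1..n. 1 / real j ^ 2)"

definition beta4 :: real where
  "beta4 = (\<Sum>k. (-1) ^ k / (1 + 2 * real k) ^ 4)"

end

theory Submission
  imports Defs "HOL-Analysis.Summation_Tests"
begin

text \<open>
  For \<open>m = n + 1/2 + j\<close> put
  \<open>g n m = n!\<^sup>2 / (\<Prod>i=1..n. m\<^sup>2 - i\<^sup>2) * (1/m\<^sup>4 - H n / m\<^sup>2)\<close>, the coefficient of \<open>x\<^sup>2\<close> in
  \<open>(\<Prod>i=1..n. i\<^sup>2 - x\<^sup>2) / ((m\<^sup>2 - x\<^sup>2) (\<Prod>i=1..n. m\<^sup>2 - i\<^sup>2))\<close>, and let \<open>S n\<close> be the alternating sum of
  \<open>g n (n + 1/2 + j)\<close> over \<open>j\<close>. Writing \<open>(n+1)\<^sup>2 - x\<^sup>2 = (m\<^sup>2 - x\<^sup>2) - (m\<^sup>2 - (n+1)\<^sup>2)\<close> gives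
  \<open>g n m + g (n+1) m = - H n * n!\<^sup>2 / (\<Prod>i=1..n+1. m\<^sup>2 - i\<^sup>2)\<close>, and the alternating sum over \<open>m\<close> of the
  right-hand side telescopes. Hence \<open>S n - S (n+1)\<close> is closed-form; it is \<open>-2/3\<close> times the
  summand of the series. Finally \<open>S 0 = 16 \<beta>(4)\<close> and \<open>S n\<close> tends to 0.
\<close>

section \<open>Products of \<open>m^2 - i^2\<close> and shifted factorials\<close>

definition sqdiff_prod :: "nat \<Rightarrow> real \<Rightarrow> real" where
  "sqdiff_prod n m = (\<Prod>i=1..n. m\<^sup>2 - (real i)\<^sup>2)"

lemma sqdiff_prod_0 [simp]: "sqdiff_prod 0 m = 1"
  by (simp add: sqdiff_prod_def)

lemma sqdiff_prod_Suc: "sqdiff_prod (Suc n) m = sqdiff_prod n m * (m\<^sup>2 - (real (Suc n))\<^sup>2)"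
  by (simp add: sqdiff_prod_def)

lemma sqdiff_prod_pos:
  assumes "real n < m"
  shows "sqdiff_prod n m > 0"
  unfolding sqdiff_prod_def
proof (rule prod_pos)
  fix i assume "i \<in> {1..n}"
  then have "real i < m" using assms by simp
  then show "0 < m\<^sup>2 - (real i)\<^sup>2" by (simp add: power_strict_mono)
qed

lemma sqdiff_prod_mono:
  assumes "real n \<le> m" "m \<le> m'"
  shows "sqdiff_prod n m \<le> sqdiff_prod n m'"
  unfolding sqdiff_prod_def
proof (rule prod_mono)
  fix i assume "i \<in> {1..n}"
  then have "real i \<le> m" using assms by simp
  then show "0 \<le> m\<^sup>2 - (real i)\<^sup>2 \<and> m\<^sup>2 - (real i)\<^sup>2 \<le> m'\<^sup>2 - (real i)\<^sup>2"
    using assms by (simp add: power_mono)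
qed

text \<open>The \<open>2 * n + 1\<close> factors run from \<open>m - n\<close> to
  \<open>m + n\<close>; pairing \<open>m - i\<close> with \<open>m + i\<close> leaves the middle
  factor \<open>m\<close>. The induction adds one factor at each end.\<close>

lemma pochhammer_eq_sqdiff_prod: "pochhammer (m - real n) (2 * n + 1) = m * sqdiff_prod n m"
proof (induction n)
  case 0
  show ?case by simp
next
  case (Suc n)
  have "pochhammer (m - real (Suc n)) (2 * Suc n + 1)
      = (m - real (Suc n)) * (pochhammer (m - real n) (2 * n + 1) * (m + real (Suc n)))"
  proof -
    have "2 * Suc n + 1 = Suc (Suc (2 * n + 1))" "m - real (Suc n) + 1 = m - real n"
      by simp_all
    then have "pochhammer (m - real (Suc n)) (2 * Suc n + 1)
        = (m - real (Suc n)) * pochhammer (m - real n) (Suc (2 * n + 1))"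
      by (simp only: pochhammer_rec)
    then show ?thesis
      by (simp only: pochhammer_Suc[of "m - real n"]) simp
  qed
  then show ?case
    by (simp only: Suc.IH sqdiff_prod_Suc) (simp add: power2_eq_square algebra_simps)
qed

lemma sqdiff_prod_half:
  "sqdiff_prod n (real n + 1/2) = pochhammer (1/2) (2 * n + 1) / (real n + 1/2)"
  using pochhammer_eq_sqdiff_prod[of "real n + 1/2" n] by (simp add: field_simps)

text \<open>The first two factors give \<open>1/2 * 3/2 = 3/4\<close>; the rest starts at
  \<open>5/2 = 2 * (5/4)\<close>, where the duplication formula applies.\<close>

lemma pochhammer_half_double:
  "pochhammer (1/2 :: real) (2 * n + 2) = 3/4 * 4 ^ n * (pochhammer (5/4) n * pochhammer (7/4) n)"
proof -
  have "pochhammer (1/2 :: real) (2 * n + 2) = 3/4 * pochhammer (2 * (5/4)) (2 * n)"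
    by (simp add: pochhammer_rec numeral_2_eq_2)
  also have "\<dots> = 3/4 * 4 ^ n * (pochhammer (5/4) n * pochhammer (7/4) n)"
    by (subst pochhammer_double) (simp add: power_mult)
  finally show ?thesis .
qed

text \<open>Source of the geometric decay in \<open>n\<close>. The constant \<open>5/4\<close> is
  the exact value of the product for \<open>n = 1\<close>, so the induction step is an equality at
  \<open>n = 0\<close>.\<close>

lemma fact_square_le_sqdiff_prod:
  "(fact n)\<^sup>2 * (5/4) ^ n \<le> sqdiff_prod n (real n + 1/2)"
proof (induction n)
  case 0
  show ?case by simp
next
  case (Suc n)
  let ?q = "sqdiff_prod n (real n + 1/2)"
  have q: "?q > 0" by (rule sqdiff_prod_pos) simp
  \<comment> \<open>The evaluation point moves with \<open>n\<close>, but the shifted factorial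
    always starts at \<open>1/2\<close>, so it only gains two factors at its upper end.\<close>
  have step: "sqdiff_prod (Suc n) (real (Suc n) + 1/2)
      = ?q * ((real n + 1/2) * (2 * real n + 3/2) * (2 * real n + 5/2) / (real n + 3/2))"
  proof -
    have "pochhammer (1/2) (2 * Suc n + 1)
        = pochhammer (1/2) (2 * n + 1) * (2 * real n + 3/2) * (2 * real n + 5/2)"
      by (simp add: pochhammer_Suc algebra_simps)
    moreover have "pochhammer (1/2) (2 * n + 1) = (real n + 1/2) * ?q"
      by (simp add: sqdiff_prod_half)
    ultimately have "pochhammer (1/2) (2 * Suc n + 1)
        = ?q * ((real n + 1/2) * (2 * real n + 3/2) * (2 * real n + 5/2))"
      by (simp only: mult_ac)
    moreover have "real (Suc n) + 1/2 = real n + 3/2" by simp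
    ultimately show ?thesis
      using sqdiff_prod_half[of "Suc n"] by (simp only: times_divide_eq_right)
  qed
  have "5/4 * (real n + 1)\<^sup>2 \<le> (real n + 1/2) * (2 * real n + 3/2) * (2 * real n + 5/2) / (real n + 3/2)"
    by (simp add: field_simps power2_eq_square)
  then have "?q * (5/4 * (real n + 1)\<^sup>2) \<le> sqdiff_prod (Suc n) (real (Suc n) + 1/2)"
    unfolding step using q by (intro mult_left_mono) auto
  moreover have "(fact n)\<^sup>2 * (5/4) ^ n * (5/4 * (real n + 1)\<^sup>2) \<le> ?q * (5/4 * (real n + 1)\<^sup>2)"
    using Suc.IH by (intro mult_right_mono) auto
  moreover have "(fact (Suc n))\<^sup>2 * (5/4) ^ Suc n = (fact n)\<^sup>2 * (5/4) ^ n * (5/4 * (real n + 1)\<^sup>2)"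
    by (simp add: power_mult_distrib add_ac)
  ultimately show ?case by linarith
qed

section \<open>Alternating sums of reciprocal products\<close>

lemma sums_alternating_inverse_sqdiff_prod:
  assumes "n > 0"
  shows "(\<lambda>j. (-1) ^ j / sqdiff_prod n (real n + 1/2 + real j)) sums (1 / (2 * pochhammer (1/2) (2 * n)))"
proof -
  \<comment> \<open>Over the common denominator \<open>2 * ?p\<close>, \<open>v j\<close> and
    \<open>v (Suc j)\<close> have numerators \<open>?a + 2 * n\<close> and \<open>?a\<close>, whose
    mean is the central factor \<open>?m\<close>.\<close>
  define v where "v j = 1 / (2 * pochhammer (1/2 + real j) (2 * n))" for j
  obtain k where k: "2 * n = Suc k" using assms by (cases n) auto
  have v_sum: "1 / sqdiff_prod n (real n + 1/2 + real j) = v j + v (Suc j)" for j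
  proof -
    let ?a = "1/2 + real j" and ?m = "real n + 1/2 + real j"
    let ?p = "pochhammer ?a (2 * n + 1)"
    have p: "?p > 0" by (rule pochhammer_pos) simp
    have expand: "1 / (2 * x) = y / (2 * (x * y))" if "y \<noteq> 0" for x y :: real
      using that by simp
    have "?p = pochhammer ?a (2 * n) * (?a + 2 * real n)"
      by (simp add: pochhammer_Suc)
    then have v0: "v j = (?a + 2 * real n) / (2 * ?p)"
      unfolding v_def by (simp only:) (rule expand, simp add: add_nonneg_eq_0_iff)
    have "?p = pochhammer (1/2 + real (Suc j)) (2 * n) * ?a"
      by (simp add: pochhammer_rec add_ac)
    then have v1: "v (Suc j) = ?a / (2 * ?p)"
      unfolding v_def by (simp only:) (rule expand, simp add: add_nonneg_eq_0_iff)
    have "?p = ?m * sqdiff_prod n ?m"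
      using pochhammer_eq_sqdiff_prod[of ?m n] by (simp add: add_ac)
    moreover have "sqdiff_prod n ?m > 0" by (rule sqdiff_prod_pos) simp
    ultimately have "1 / sqdiff_prod n ?m = ?m / ?p" by simp
    also have "\<dots> = v j + v (Suc j)"
      unfolding v0 v1 using p by (simp add: field_simps)
    finally show ?thesis .
  qed
  \<comment> \<open>The first factor gives \<open>1/2 + j\<close>; the other \<open>k\<close>
    factors are at least \<open>1, ..., k\<close>. Such a first factor exists because
    \<open>n > 0\<close>.\<close>
  have v_le: "norm (v j) \<le> inverse (real (Suc j))" for j
  proof -
    have "(1::real) \<le> fact k" by (rule fact_ge_1)
    also have "\<dots> = pochhammer 1 k" by (simp add: pochhammer_fact)
    also have "\<dots> \<le> pochhammer (1/2 + real j + 1) k"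
      unfolding pochhammer_prod by (intro prod_mono) auto
    finally have "1/2 + real j \<le> pochhammer (1/2 + real j) (2 * n)"
      by (simp add: k pochhammer_rec mult_le_cancel_left1)
    moreover have "pochhammer (1/2 + real j) (2 * n) > 0" by (rule pochhammer_pos) simp
    ultimately show ?thesis
      by (simp add: v_def field_simps)
  qed
  have "v \<longlonglongrightarrow> 0"
    by (rule Lim_null_comparison[OF _ LIMSEQ_inverse_real_of_nat]) (simp only: v_le eventually_True)
  \<comment> \<open>Differences of consecutive terms of this sequence are
    \<open>(-1) ^ j * (v j + v (Suc j))\<close>, so the sum is its term at
    \<open>j = 0\<close>.\<close>
  then have "(\<lambda>j. (-1) ^ j * v j) \<longlonglongrightarrow> 0"
    by (subst tendsto_norm_zero_iff[symmetric]) (simp add: abs_mult tendsto_rabs_zero_iff)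
  from telescope_sums'[OF this] show ?thesis
    by (simp add: v_def[of 0] v_sum[symmetric] flip: distrib_left)
qed

section \<open>The coefficients and their recurrence\<close>

text \<open>The \<open>g\<close> of the overview, with \<open>harm2\<close> as
  \<open>H\<close>.\<close>

definition acc_term :: "nat \<Rightarrow> real \<Rightarrow> real" where
  "acc_term n m = (fact n)\<^sup>2 / sqdiff_prod n m * (1 / m ^ 4 - harm2 n / m\<^sup>2)"

lemma harm2_Suc: "harm2 (Suc n) = harm2 n + 1 / (real (Suc n))\<^sup>2"
  by (simp add: harm2_def)

lemma harm2_bounds: "0 \<le> harm2 n" "harm2 n \<le> real n"
proof -
  show "0 \<le> harm2 n" unfolding harm2_def by (intro sum_nonneg) simp
  have "harm2 n \<le> (\<Sum>j=1..n. 1)" unfolding harm2_def by (intro sum_mono) auto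
  then show "harm2 n \<le> real n" by simp
qed

lemma acc_term_Suc:
  assumes "real (Suc n) < m"
  shows "acc_term n m + acc_term (Suc n) m = - harm2 n * (fact n)\<^sup>2 / sqdiff_prod (Suc n) m"
proof -
  define d where "d = m\<^sup>2 - (real (Suc n))\<^sup>2"
  have m: "m \<noteq> 0" and d: "d \<noteq> 0"
    using assms power_strict_mono[OF assms, of 2]
    by (auto simp: d_def)
  define s where "s = real (Suc n)"
  have s: "s \<noteq> 0" "m\<^sup>2 = d + s\<^sup>2" "m\<^sup>2 - s\<^sup>2 = d" by (simp_all add: s_def d_def)
  have fs: "(fact (Suc n) :: real) = s * fact n" by (simp add: s_def)
  have m4: "m ^ 4 = m\<^sup>2 * m\<^sup>2" by (simp flip: power_add)
  \<comment> \<open>With the common factor \<open>(fact n)^2 / sqdiff_prod n m\<close> removed, the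
    recurrence is a rational identity in \<open>d\<close>, \<open>s\<close> and
    \<open>harm2 n\<close>, since \<open>m^2 = d + s^2\<close>.\<close>
  have key: "1 / m ^ 4 - harm2 n / m\<^sup>2 + s\<^sup>2 / d * (1 / m ^ 4 - (harm2 n + 1 / s\<^sup>2) / m\<^sup>2) = - harm2 n / d"
  proof -
    have "m\<^sup>2 \<noteq> 0" using m by simp
    then have "d + s\<^sup>2 \<noteq> 0" using s by simp
    then show ?thesis
      unfolding m4 s(2) using s(1) d by (simp add: divide_simps) algebra
  qed
  have factor: "f\<^sup>2 / q * a + (s * f)\<^sup>2 / (q * d) * b = f\<^sup>2 / q * (a + s\<^sup>2 / d * b)"
    for f q a b :: real
    by (simp add: power_mult_distrib distrib_left mult_ac)
  have "acc_term n m + acc_term (Suc n) m = (fact n)\<^sup>2 / sqdiff_prod n m *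
      (1 / m ^ 4 - harm2 n / m\<^sup>2 + s\<^sup>2 / d * (1 / m ^ 4 - (harm2 n + 1 / s\<^sup>2) / m\<^sup>2))"
    unfolding acc_term_def sqdiff_prod_Suc harm2_Suc fs s_def[symmetric] s(3)
    by (rule factor)
  also have "\<dots> = - harm2 n * (fact n)\<^sup>2 / sqdiff_prod (Suc n) m"
    unfolding key by (simp add: sqdiff_prod_Suc d_def)
  finally show ?thesis .
qed

text \<open>The bound separates the variables: summable in \<open>j\<close>, which gives
  convergence, and tending to 0 in \<open>n\<close>, which sends the whole sum to 0.\<close>

lemma abs_acc_term_le:
  "\<bar>acc_term n (real n + 1/2 + real j)\<bar> \<le> (4/5) ^ n * (real n + 4) * (4 * inverse (real (Suc j) ^ 2))"
proof -
  define m where "m = real n + 1/2 + real j"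
  have m: "m > 0" "1/2 \<le> m" by (auto simp: m_def)
  have q: "sqdiff_prod n m > 0" by (rule sqdiff_prod_pos) (simp add: m_def)
  have "(fact n)\<^sup>2 * (5/4) ^ n \<le> sqdiff_prod n m"
    using fact_square_le_sqdiff_prod[of n] sqdiff_prod_mono[of n "real n + 1/2" m]
    by (simp add: m_def)
  then have w: "(fact n)\<^sup>2 / sqdiff_prod n m \<le> (4/5) ^ n"
    using q by (simp add: field_simps power_divide)
  \<comment> \<open>Since \<open>m\<close> is at least \<open>1/2\<close>, the quartic term is at
    most \<open>4 / m^2\<close>; this is the 4 in \<open>real n + 4\<close>.\<close>
  have "1/4 \<le> m\<^sup>2" using power_mono[OF m(2), of 2] by (simp add: power2_eq_square)
  then have "1 / (m\<^sup>2 * m\<^sup>2) \<le> 4 / m\<^sup>2"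
    using m by (subst divide_divide_eq_left[symmetric], intro divide_right_mono) (simp_all add: field_simps)
  then have "1 / m ^ 4 \<le> 4 / m\<^sup>2" by (simp flip: power_add)
  moreover have "harm2 n / m\<^sup>2 \<le> real n / m\<^sup>2" "0 \<le> harm2 n / m\<^sup>2"
    using harm2_bounds[of n] by (auto intro: divide_right_mono)
  moreover have "0 \<le> 1 / m ^ 4" by simp
  ultimately have "\<bar>1 / m ^ 4 - harm2 n / m\<^sup>2\<bar> \<le> real n / m\<^sup>2 + 4 / m\<^sup>2"
    by linarith
  also have "\<dots> = (real n + 4) * (1 / m\<^sup>2)" by (simp add: add_divide_distrib)
  also have "\<dots> \<le> (real n + 4) * (4 * inverse (real (Suc j) ^ 2))"
  proof (rule mult_left_mono)
    \<comment> \<open>The other factor 4 comes from \<open>m\<close> being at least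
      \<open>(j + 1) / 2\<close>.\<close>
    have "(real (Suc j) / 2)\<^sup>2 \<le> m\<^sup>2" by (rule power_mono) (auto simp: m_def)
    then show "1 / m\<^sup>2 \<le> 4 * inverse (real (Suc j) ^ 2)"
      using m by (simp add: field_simps)
  qed simp
  finally have b: "\<bar>1 / m ^ 4 - harm2 n / m\<^sup>2\<bar> \<le> (real n + 4) * (4 * inverse (real (Suc j) ^ 2))" .
  have "\<bar>acc_term n m\<bar> = (fact n)\<^sup>2 / sqdiff_prod n m * \<bar>1 / m ^ 4 - harm2 n / m\<^sup>2\<bar>"
    using q by (simp add: acc_term_def abs_mult)
  also have "\<dots> \<le> (4/5) ^ n * ((real n + 4) * (4 * inverse (real (Suc j) ^ 2)))"
    using w b q by (intro mult_mono) auto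
  finally show ?thesis by (simp add: m_def mult.assoc)
qed

section \<open>The alternating sums, their limit and their differences\<close>

text \<open>The \<open>S\<close> of the overview.\<close>

definition acc_sum :: "nat \<Rightarrow> real" where
  "acc_sum n = (\<Sum>j. (-1) ^ j * acc_term n (real n + 1/2 + real j))"

lemma summable_inverse_squares_Suc: "summable (\<lambda>j. inverse (real (Suc j) ^ 2))"
  using inverse_power_summable[of 2, where 'a = real] by (subst summable_Suc_iff) simp

lemma acc_sum_sums: "(\<lambda>j. (-1) ^ j * acc_term n (real n + 1/2 + real j)) sums acc_sum n"
  unfolding acc_sum_def
proof (rule summable_sums, rule summable_comparison_test')
  show "summable (\<lambda>j. (4/5) ^ n * (real n + 4) * (4 * inverse (real (Suc j) ^ 2)))"
    by (intro summable_mult summable_inverse_squares_Suc)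
  show "norm ((-1) ^ j * acc_term n (real n + 1/2 + real j))
      \<le> (4/5) ^ n * (real n + 4) * (4 * inverse (real (Suc j) ^ 2))" if "j \<ge> 0" for j
    using abs_acc_term_le[of n j] by (simp add: abs_mult)
qed

lemma acc_sum_tendsto_0: "acc_sum \<longlonglongrightarrow> 0"
proof -
  define C where "C = (\<Sum>j. 4 * inverse (real (Suc j) ^ 2))"
  have sm: "summable (\<lambda>j. 4 * inverse (real (Suc j) ^ 2))"
    by (intro summable_mult summable_inverse_squares_Suc)
  have bound: "norm (acc_sum n) \<le> (4/5) ^ n * (real n + 4) * C" for n
  proof -
    have "norm (acc_sum n) \<le> (\<Sum>j. (4/5) ^ n * (real n + 4) * (4 * inverse (real (Suc j) ^ 2)))"
      unfolding acc_sum_def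
    proof (rule norm_suminf_le)
      show "summable (\<lambda>j. (4/5) ^ n * (real n + 4) * (4 * inverse (real (Suc j) ^ 2)))"
        by (intro summable_mult[OF sm])
      show "norm ((-1) ^ j * acc_term n (real n + 1/2 + real j))
          \<le> (4/5) ^ n * (real n + 4) * (4 * inverse (real (Suc j) ^ 2))" for j
        using abs_acc_term_le[of n j] by (simp add: abs_mult)
    qed
    also have "\<dots> = (4/5) ^ n * (real n + 4) * C"
      unfolding C_def by (rule suminf_mult[OF sm])
    finally show ?thesis .
  qed
  have "(\<lambda>n. (real n * (4/5) ^ n + 4 * (4/5) ^ n) * C) \<longlonglongrightarrow> (0 + 4 * 0) * C"
    by (intro tendsto_intros powser_times_n_limit_0 LIMSEQ_power_zero) auto
  then have "(\<lambda>n. (4/5) ^ n * (real n + 4) * C) \<longlonglongrightarrow> 0"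
    by (simp add: algebra_simps)
  then show ?thesis
    by (rule Lim_null_comparison[rotated]) (simp only: bound eventually_True)
qed

text \<open>The points for \<open>Suc n\<close> are those for \<open>n\<close> without the first.
  Dropping that term shifts the index and flips the sign, so the difference pairs
  \<open>acc_term n\<close> with \<open>acc_term (Suc n)\<close> at equal points, where the
  recurrence applies.\<close>

lemma acc_sum_diff:
  "acc_sum n - acc_sum (Suc n)
     = acc_term n (real n + 1/2) + harm2 n * (fact n)\<^sup>2 / (2 * pochhammer (1/2) (2 * n + 2))"
proof -
  let ?f = "\<lambda>j. (-1) ^ j * acc_term n (real n + 1/2 + real j)"
  have "(\<lambda>j. ?f (Suc j)) sums (acc_sum n - ?f 0)"
    using acc_sum_sums[of n] by (intro iffD2[OF sums_Suc_iff]) simp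
  moreover have "(\<lambda>j. harm2 n * (fact n)\<^sup>2 * ((-1) ^ j / sqdiff_prod (Suc n) (real (Suc n) + 1/2 + real j)))
      sums (harm2 n * (fact n)\<^sup>2 * (1 / (2 * pochhammer (1/2) (2 * Suc n))))"
    by (intro sums_mult sums_alternating_inverse_sqdiff_prod) simp
  ultimately have "(\<lambda>j. ?f (Suc j) - harm2 n * (fact n)\<^sup>2 * ((-1) ^ j / sqdiff_prod (Suc n) (real (Suc n) + 1/2 + real j)))
      sums (acc_sum n - ?f 0 - harm2 n * (fact n)\<^sup>2 * (1 / (2 * pochhammer (1/2) (2 * Suc n))))"
    by (rule sums_diff)
  moreover have "?f (Suc j) - harm2 n * (fact n)\<^sup>2 * ((-1) ^ j / sqdiff_prod (Suc n) (real (Suc n) + 1/2 + real j))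
      = (-1) ^ j * acc_term (Suc n) (real (Suc n) + 1/2 + real j)" for j
  proof -
    define m where "m = real (Suc n) + 1/2 + real j"
    have e: "real n + 1/2 + real (Suc j) = m" by (simp add: m_def)
    have eq: "acc_term (Suc n) m = - harm2 n * (fact n)\<^sup>2 / sqdiff_prod (Suc n) m - acc_term n m"
      using acc_term_Suc[of n m] by (simp add: m_def)
    then show ?thesis
      unfolding e m_def[symmetric] eq by (simp add: algebra_simps)
  qed
  ultimately have "(\<lambda>j. (-1) ^ j * acc_term (Suc n) (real (Suc n) + 1/2 + real j))
      sums (acc_sum n - ?f 0 - harm2 n * (fact n)\<^sup>2 * (1 / (2 * pochhammer (1/2) (2 * Suc n))))"
    by simp
  from sums_unique2[OF this acc_sum_sums[of "Suc n"]] show ?thesis by simp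
qed

text \<open>Here \<open>m = (1 + 2 * j) / 2\<close> and \<open>harm2 0 = 0\<close>; the 16 is
  \<open>2 ^ 4\<close>.\<close>

lemma acc_sum_0: "acc_sum 0 = 16 * beta4"
proof -
  have eq: "(-1) ^ j * acc_term 0 (real 0 + 1/2 + real j) = 16 * ((-1) ^ j / (1 + 2 * real j) ^ 4)" for j
  proof -
    have half: "real 0 + 1/2 + real j = (1 + 2 * real j) / 2" by simp
    show ?thesis
      unfolding half by (simp add: acc_term_def harm2_def power_divide)
  qed
  have "(\<lambda>j. 16 * ((-1) ^ j / (1 + 2 * real j) ^ 4)) sums acc_sum 0"
    using acc_sum_sums[of 0] unfolding eq .
  then have "(\<lambda>j. 1/16 * (16 * ((-1) ^ j / (1 + 2 * real j) ^ 4))) sums (1/16 * acc_sum 0)"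
    by (rule sums_mult)
  then have "(\<lambda>j. (-1) ^ j / (1 + 2 * real j) ^ 4) sums (acc_sum 0 / 16)" by simp
  from sums_unique[OF this] show ?thesis by (simp add: beta4_def)
qed

section \<open>Matching the series\<close>

lemma acc_sum_diff_eq_summand:
  "- (3/2) * (acc_sum k - acc_sum (Suc k))
     = (1 / 4) ^ k
        * ((pochhammer 1 k) ^ 2 / (pochhammer (5 / 4) k * pochhammer (7 / 4) k))
        * ((5 + 6 * real k) / (1 + 2 * real k) * harm2 k
           - (24 + 32 * real k) / (1 + 2 * real k) ^ 3)"
proof -
  define F :: real where "F = (fact k)\<^sup>2"
  define P :: real where "P = 4 ^ k * (pochhammer (5/4) k * pochhammer (7/4) k)"
  define t where "t = 1 + 2 * real k"
  define h where "h = harm2 k"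
  have P: "P > 0" unfolding P_def by (intro mult_pos_pos pochhammer_pos) auto
  have t: "t > 0" by (simp add: t_def)
  have k: "real k = (t - 1) / 2" by (simp add: t_def)
  have m: "real k + 1/2 = t / 2" by (simp add: t_def)
  have double: "pochhammer (1/2) (2 * k + 2) = 3/4 * P"
    unfolding P_def pochhammer_half_double by simp
  \<comment> \<open>The last factor of \<open>pochhammer (1/2) (2 * k + 2)\<close> is
    \<open>2 * k + 3/2 = t + 1/2\<close>.\<close>
  have "3/4 * P = pochhammer (1/2) (2 * k + 1) * (t + 1/2)"
    unfolding double[symmetric] by (simp add: pochhammer_Suc t_def)
  also have "pochhammer (1/2) (2 * k + 1) = t / 2 * sqdiff_prod k (t / 2)"
    using sqdiff_prod_half[of k] t unfolding m by simp
  finally have q: "sqdiff_prod k (t / 2) = 3/4 * P / ((t + 1/2) * (t / 2))"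
    using t by (simp only:) simp
  have lhs: "acc_sum k - acc_sum (Suc k) =
      F / (3/4 * P / ((t + 1/2) * (t / 2))) * (1 / (t/2) ^ 4 - h / (t/2)\<^sup>2) + h * F / (2 * (3/4 * P))"
    unfolding acc_sum_diff acc_term_def m q double F_def h_def ..
  have rhs: "(1 / 4 :: real) ^ k * ((pochhammer 1 k) ^ 2 / (pochhammer (5 / 4) k * pochhammer (7 / 4) k)) = F / P"
    unfolding F_def P_def by (simp add: pochhammer_fact[symmetric] power_divide)
  \<comment> \<open>In terms of \<open>t\<close> the numerators \<open>5 + 6 * k\<close> and
    \<open>24 + 32 * k\<close> are \<open>3 * t + 2\<close> and \<open>16 * t + 8\<close>;
    \<open>F / P\<close> is a common factor of both sides.\<close>
  show ?thesis
    unfolding rhs lhs t_def[symmetric] h_def[symmetric] k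
    using P t by (simp add: field_simps power2_eq_square power3_eq_cube power4_eq_xxxx)
qed

theorem theorem1p3:
  "(\<lambda>k. (1 / 4 :: real) ^ k
        * ((pochhammer 1 k) ^ 2 / (pochhammer (5 / 4) k * pochhammer (7 / 4) k))
        * ((5 + 6 * real k) / (1 + 2 * real k) * harm2 k
           - (24 + 32 * real k) / (1 + 2 * real k) ^ 3))
   sums (- 24 * beta4)"
proof -
  \<comment> \<open>The telescoped value is \<open>- (3/2) * 16 * beta4\<close>, hence the constant
    \<open>-24\<close>.\<close>
  have "(\<lambda>k. - (3/2) * (acc_sum k - acc_sum (Suc k))) sums (- (3/2) * (acc_sum 0 - 0))"
    by (intro sums_mult telescope_sums' acc_sum_tendsto_0)
  then show ?thesis
    unfolding acc_sum_diff_eq_summand acc_sum_0 by simp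
qed

end
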